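(* There exist infinitely many antimatter Puiseux monoids that are not strongly bounded.
   Context: A Puiseux monoid is an additive submonoid of $\mathbb{Q}_{\ge 0}$. For $r\in\mathbb{Q}_{>0}$, $\mathsf{n}(r)$ is the numerator of $r$ written in lowest terms with positive numerator and denominator. A set $S$ of positive rationals is strongly bounded if $\{\mathsf{n}(s)\mid s\in S\}$ is bounded. A Puiseux monoid is strongly bounded if it can be generated (as a monoid) by a strongly bounded set. An atom of $M$ is a nonzero $a\in M$ such that $a=x+y$ with $x,y\in M$ implies $x=0$ or $y=0$; $M$ is antimatter if it has no atoms. *)

theory Defs
  imports Complex_Main
begin

definition add_submonoid :: "'a::monoid_add set \<Rightarrow> bool" where
  "add_submonoid M \<longleftrightarrow> 0 \<in> M \<and> (\<forall>x\<in>M. \<forall>y\<in>M. x + y \<in> M)"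

definition puiseux_monoid :: "rat set \<Rightarrow> bool" where
  "puiseux_monoid M \<longleftrightarrow> add_submonoid M \<and> M \<subseteq> {0..}"

(* quotient_of returns the coprime pair with positive denominator *)
definition numerator :: "rat \<Rightarrow> int" where
  "numerator r = fst (quotient_of r)"

definition strongly_bounded_set :: "rat set \<Rightarrow> bool" where
  "strongly_bounded_set S \<longleftrightarrow> S \<subseteq> {0<..} \<and> bdd_above (numerator ` S)"

(* add_submonoid hull S is the smallest additive submonoid containing S *)
definition strongly_bounded_monoid :: "rat set \<Rightarrow> bool" where
  "strongly_bounded_monoid M \<longleftrightarrow> (\<exists>S. strongly_bounded_set S \<and> add_submonoid hull S = M)"

definition atom_of :: "'a::monoid_add set \<Rightarrow> 'a \<Rightarrow> bool" where
  "atom_of M a \<longleftrightarrow> a \<in> M \<and> a \<noteq> 0 \<and> (\<forall>x\<in>M. \<forall>y\<in>M. a = x + y \<longrightarrow> x = 0 \<or> y = 0)"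

definition antimatter :: "'a::monoid_add set \<Rightarrow> bool" where
  "antimatter M \<longleftrightarrow> (\<nexists>a. atom_of M a)"

end

theory Submission
  imports Defs
begin

text \<open>
  The idea is to force small elements to have large numerators. Write \<open>v\<close> for the 2-adic
  valuation on the rationals and let \<open>g\<close> be a decreasing function on the positive rationals.
  Since \<open>v (x + y) \<ge> min (v x) (v y)\<close> and \<open>g (x + y) \<le> min (g x) (g y)\<close>, the positive \<open>x\<close> with
  \<open>v x \<ge> g x\<close> form, together with 0, a Puiseux monoid. Here \<open>g x\<close> is the least \<open>n \<ge> m\<close> with
  \<open>x > 1 / (n + 2)\<close>, for a parameter \<open>m\<close>.

  As \<open>g x\<close> tends to infinity for \<open>x\<close> tending to 0, and as \<open>2 ^ v x\<close> divides the numerator when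
  \<open>v x \<ge> 0\<close>, a set of elements with bounded numerators stays away from 0, and then so does
  every nonzero element that it generates. But the monoid has arbitrarily small positive elements
  (\<open>small_element_exists\<close>), so it is not strongly bounded.

  The function \<open>g\<close> is locally constant to the left of every point. Hence subtracting a sufficiently
  small element \<open>z\<close> of the monoid from \<open>x\<close> does not change the condition on the valuation, and
  \<open>x = (x - z) + z\<close> is a proper decomposition: there are no atoms. Finally, \<open>m\<close> is the least
  valuation of a nonzero element, so different parameters yield different monoids.
\<close>

section \<open>Rationals divisible by a power of 2\<close>

text \<open>The ideal generated by \<open>2 ^ n\<close> in the localization of the integers at 2.\<close>

definition two_adic_ideal :: "nat \<Rightarrow> rat set" where
  "two_adic_ideal n = {x. \<exists>a b::int. odd b \<and> x * of_int b = 2 ^ n * of_int a}"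

lemma two_adic_ideal_add:
  assumes "x \<in> two_adic_ideal n" "y \<in> two_adic_ideal n"
  shows "x + y \<in> two_adic_ideal n"
proof -
  obtain a b c d :: int where ab: "odd b" "x * of_int b = 2 ^ n * of_int a"
    and cd: "odd d" "y * of_int d = 2 ^ n * of_int c"
    using assms unfolding two_adic_ideal_def by blast
  have "(x + y) * of_int (b * d) = (x * of_int b) * of_int d + (y * of_int d) * of_int b"
    by (simp add: algebra_simps)
  also have "\<dots> = 2 ^ n * of_int (a * d + c * b)"
    by (simp add: ab cd algebra_simps)
  finally show ?thesis
    unfolding two_adic_ideal_def using ab(1) cd(1)
    by (metis (mono_tags, lifting) even_mult_iff mem_Collect_eq)
qed

lemma two_adic_ideal_uminus:
  assumes "x \<in> two_adic_ideal n"
  shows "- x \<in> two_adic_ideal n"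
proof -
  obtain a b :: int where ab: "odd b" "x * of_int b = 2 ^ n * of_int a"
    using assms unfolding two_adic_ideal_def by blast
  then have "- x * of_int b = 2 ^ n * of_int (- a)" by simp
  then show ?thesis unfolding two_adic_ideal_def using ab(1) by blast
qed

lemma two_adic_ideal_antimono:
  assumes "n \<le> k"
  shows "two_adic_ideal k \<subseteq> two_adic_ideal n"
proof
  fix x assume "x \<in> two_adic_ideal k"
  then obtain a b :: int where ab: "odd b" "x * of_int b = 2 ^ k * of_int a"
    unfolding two_adic_ideal_def by blast
  have "(2::rat) ^ k = 2 ^ n * 2 ^ (k - n)"
    using assms by (simp flip: power_add)
  then have "x * of_int b = 2 ^ n * of_int (2 ^ (k - n) * a)"
    using ab(2) by simp
  then show "x \<in> two_adic_ideal n"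
    unfolding two_adic_ideal_def using ab(1) by blast
qed

lemma power_two_dvd_numerator:
  assumes "x \<in> two_adic_ideal n"
  shows "2 ^ n dvd numerator x"
proof -
  obtain a b :: int where ab: "odd b" "x * of_int b = 2 ^ n * of_int a"
    using assms unfolding two_adic_ideal_def by blast
  obtain p q where pq: "quotient_of x = (p, q)" by force
  have p: "of_int p = x * of_int q"
    using quotient_of_denom_pos[OF pq] quotient_of_div[OF pq] by simp
  have "(of_int (p * b) :: rat) = x * of_int b * of_int q"
    by (simp add: p)
  also have "\<dots> = of_int (2 ^ n * (a * q))"
    by (simp add: ab(2))
  finally have "p * b = 2 ^ n * (a * q)" by (simp only: of_int_eq_iff)
  then have "2 ^ n dvd p * b" by simp
  moreover have "coprime (2 ^ n) b" using ab(1) by simp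
  ultimately show ?thesis
    by (simp add: numerator_def pq coprime_dvd_mult_left_iff)
qed

lemma numerator_pos:
  assumes "x > 0"
  shows "numerator x > 0"
proof -
  obtain p q where pq: "quotient_of x = (p, q)" by force
  have "q > 0" "x = of_int p / of_int q"
    using quotient_of_denom_pos[OF pq] quotient_of_div[OF pq] by auto
  then have "p > 0" using assms by (simp add: zero_less_divide_iff)
  then show ?thesis by (simp add: numerator_def pq)
qed

section \<open>Monoids whose small elements have large valuation\<close>

definition staircase_monoid :: "nat \<Rightarrow> rat set" where
  "staircase_monoid m =
    insert 0 {x. \<exists>n\<ge>m. x \<in> two_adic_ideal n \<and> 1 < of_nat (n + 2) * x}"

lemma staircase_monoidI:
  assumes "m \<le> n" "x \<in> two_adic_ideal n" "1 < of_nat (n + 2) * x"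
  shows "x \<in> staircase_monoid m"
  using assms unfolding staircase_monoid_def by blast

lemma staircase_monoidE:
  assumes "x \<in> staircase_monoid m" "x \<noteq> 0"
  obtains n where "m \<le> n" "x \<in> two_adic_ideal n" "1 < of_nat (n + 2) * x"
  using assms unfolding staircase_monoid_def by blast

lemma pos_if_threshold:
  assumes "1 < of_nat (n + 2) * (x::rat)"
  shows "0 < x"
  using assms by (metis less_trans of_nat_0_le_iff zero_less_mult_pos zero_less_one
      of_nat_0_less_iff add_2_eq_Suc' zero_less_Suc)

text \<open>The witness \<open>2 ^ N / (2 ^ N * (N + 2) - 1)\<close> has an odd denominator and lies just
  above the threshold \<open>1 / (N + 2)\<close>.\<close>

lemma small_element_exists:
  fixes \<delta> :: rat
  assumes "\<delta> > 0"
  obtains N z where "n \<le> N" "z \<in> two_adic_ideal N" "1 < of_nat (N + 2) * z" "z < \<delta>"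
proof -
  obtain K :: nat where K: "2 / \<delta> < of_nat K" using reals_Archimedean2 by blast
  define N where "N = Suc (n + K)"
  define b :: int where "b = 2 ^ N * (int N + 2) - 1"
  define z :: rat where "z = 2 ^ N / of_int b"
  have "odd b" by (simp add: b_def N_def)
  have "(2::int) ^ N * (int N + 2) \<ge> 1 * 2" by (intro mult_mono) auto
  then have b1: "b \<ge> 1" by (simp add: b_def)
  have "z * of_int b = 2 ^ N * of_int 1" using b1 by (simp add: z_def)
  then have z: "z \<in> two_adic_ideal N"
    unfolding two_adic_ideal_def using \<open>odd b\<close> by blast
  have "(of_int (b + 1) :: rat) = of_nat (N + 2) * 2 ^ N"
    by (simp add: b_def algebra_simps)
  then have eq: "of_nat (N + 2) * z = of_int (b + 1) / of_int b"
    by (simp add: z_def)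
  have "1 < of_nat (N + 2) * z" using b1 unfolding eq by simp
  moreover have "z < \<delta>"
  proof -
    have "of_nat (N + 2) * z \<le> 2" using b1 unfolding eq by (simp add: field_simps)
    also have "2 < of_nat K * \<delta>" using K assms by (simp add: field_simps)
    also have "\<dots> \<le> of_nat (N + 2) * \<delta>"
      using assms by (intro mult_right_mono) (simp_all add: N_def)
    finally show ?thesis by (simp del: of_nat_add)
  qed
  ultimately show ?thesis using that[of N z] z by (simp add: N_def)
qed

text \<open>For a sum, the smaller of the two levels \<open>n\<close> is a witness: the ideals decrease in \<open>n\<close>, and
  adding a nonnegative number keeps the summand above its threshold.\<close>

lemma puiseux_staircase_monoid: "puiseux_monoid (staircase_monoid m)"
proof -
  have nonneg: "0 \<le> x" if "x \<in> staircase_monoid m" for x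
    using that pos_if_threshold unfolding staircase_monoid_def by (auto intro: less_imp_le)
  have add: "x + y \<in> staircase_monoid m"
    if "m \<le> n" "n \<le> k" "x \<in> two_adic_ideal n" "y \<in> two_adic_ideal k"
      "1 < of_nat (n + 2) * x" "0 \<le> y" for x y n k
  proof (rule staircase_monoidI[OF that(1)])
    show "x + y \<in> two_adic_ideal n"
      using that two_adic_ideal_antimono two_adic_ideal_add by blast
    have "of_nat (n + 2) * x \<le> of_nat (n + 2) * (x + y)"
      using that(6) by (intro mult_left_mono) auto
    then show "1 < of_nat (n + 2) * (x + y)" using that(5) by linarith
  qed
  have "x + y \<in> staircase_monoid m"
    if x: "x \<in> staircase_monoid m" and y: "y \<in> staircase_monoid m" for x y
  proof (cases "x = 0 \<or> y = 0")
    case True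
    then show ?thesis using x y by auto
  next
    case False
    obtain n where n: "m \<le> n" "x \<in> two_adic_ideal n" "1 < of_nat (n + 2) * x"
      using x False by (blast elim: staircase_monoidE)
    obtain k where k: "m \<le> k" "y \<in> two_adic_ideal k" "1 < of_nat (k + 2) * y"
      using y False by (blast elim: staircase_monoidE)
    show ?thesis
    proof (cases "n \<le> k")
      case True
      then show ?thesis using add[of n k x y] n k nonneg[OF y] by blast
    next
      case False
      then have "y + x \<in> staircase_monoid m"
        using add[of k n y x] n k nonneg[OF x] by simp
      then show ?thesis by (simp add: add.commute)
    qed
  qed
  then show ?thesis
    using nonneg unfolding puiseux_monoid_def add_submonoid_def
    by (auto simp: staircase_monoid_def)
qed

text \<open>The threshold inequality is strict, so it leaves room to split off a small element.\<close>

lemma antimatter_staircase_monoid: "antimatter (staircase_monoid m)"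
  unfolding antimatter_def
proof
  assume "\<exists>x. atom_of (staircase_monoid m) x"
  then obtain x where x: "x \<in> staircase_monoid m" "x \<noteq> 0"
    and atom: "\<And>y z. \<lbrakk>y \<in> staircase_monoid m; z \<in> staircase_monoid m; x = y + z\<rbrakk> \<Longrightarrow> y = 0 \<or> z = 0"
    unfolding atom_of_def by blast
  obtain n where n: "m \<le> n" "x \<in> two_adic_ideal n" "1 < of_nat (n + 2) * x"
    using x by (rule staircase_monoidE)
  have "x - 1 / of_nat (n + 2) > 0" using n(3) by (simp add: field_simps del: of_nat_add)
  then obtain N z where N: "n \<le> N" "z \<in> two_adic_ideal N" "1 < of_nat (N + 2) * z"
    and z: "z < x - 1 / of_nat (n + 2)"
    by (rule small_element_exists)
  have "x + - z \<in> two_adic_ideal n"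
    using n(2) N(1,2) two_adic_ideal_antimono two_adic_ideal_add two_adic_ideal_uminus by blast
  then have y: "x - z \<in> two_adic_ideal n" by simp
  have "1 / of_nat (n + 2) < x - z" using z by linarith
  then have y': "1 < of_nat (n + 2) * (x - z)"
    by (simp add: field_simps del: of_nat_add)
  have "x - z \<in> staircase_monoid m" "z \<in> staircase_monoid m"
    using staircase_monoidI n(1) N y y' order_trans by blast+
  then have "x - z = 0 \<or> z = 0" using atom[of "x - z" z] by simp
  then show False
    using pos_if_threshold[OF y'] pos_if_threshold[OF N(3)] by auto
qed

text \<open>Bounded numerators bound the valuations, hence the levels \<open>n\<close>, of the generators, so these
  are at least some \<open>\<epsilon> > 0\<close>. The sums of such generators then avoid the interval \<open>(0, \<epsilon>)\<close>.\<close>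

lemma not_strongly_bounded_staircase_monoid: "\<not> strongly_bounded_monoid (staircase_monoid m)"
proof
  assume "strongly_bounded_monoid (staircase_monoid m)"
  then obtain S where pos: "S \<subseteq> {0<..}" and bdd: "bdd_above (numerator ` S)"
    and hull: "add_submonoid hull S = staircase_monoid m"
    unfolding strongly_bounded_monoid_def strongly_bounded_set_def by blast
  obtain B where B: "\<And>s. s \<in> S \<Longrightarrow> numerator s \<le> B"
    using bdd unfolding bdd_above_def by blast
  define \<epsilon> :: rat where "\<epsilon> = 1 / of_nat (nat B + 2)"
  have "\<epsilon> > 0" by (simp add: \<epsilon>_def add_pos_pos)
  have "\<epsilon> \<le> s" if s: "s \<in> S" for s
  proof -
    have "s > 0" using pos s by auto
    have "s \<in> staircase_monoid m" using hull_inc[OF s, of add_submonoid] hull by simp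
    then obtain n where n: "s \<in> two_adic_ideal n" "1 < of_nat (n + 2) * s"
      using \<open>s > 0\<close> by (blast elim: staircase_monoidE)
    have "int n < 2 ^ n" by (metis of_nat_less_two_power)
    also have "\<dots> \<le> numerator s"
      using power_two_dvd_numerator[OF n(1)] numerator_pos[OF \<open>s > 0\<close>] by (rule zdvd_imp_le)
    also have "\<dots> \<le> B" using B[OF s] .
    finally have "n + 2 \<le> nat B + 2" by simp
    then have "of_nat (n + 2) * s \<le> of_nat (nat B + 2) * s"
      using \<open>s > 0\<close> by (intro mult_right_mono of_nat_mono) auto
    then have "1 \<le> of_nat (nat B + 2) * s" using n(2) by linarith
    then show ?thesis by (simp add: \<epsilon>_def field_simps del: of_nat_add)
  qed
  then have "S \<subseteq> insert 0 {\<epsilon>..}" by auto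
  moreover have "add_submonoid (insert 0 {\<epsilon>..})"
    using \<open>\<epsilon> > 0\<close> unfolding add_submonoid_def by auto
  ultimately have away: "staircase_monoid m \<subseteq> insert 0 {\<epsilon>..}"
    using hull_minimal[of S _ add_submonoid] hull by metis
  obtain N z where N: "m \<le> N" "z \<in> two_adic_ideal N" "1 < of_nat (N + 2) * z" "z < \<epsilon>"
    using \<open>\<epsilon> > 0\<close> by (rule small_element_exists)
  have "z \<in> staircase_monoid m" using staircase_monoidI N(1-3) .
  then show False using away N(4) pos_if_threshold[OF N(3)] by auto
qed

text \<open>The element \<open>2 ^ m\<close> separates the monoid with parameter \<open>m\<close> from those with a larger one.\<close>

lemma inj_staircase_monoid: "inj staircase_monoid"
proof (rule linorder_injI)
  fix m k :: nat assume "m < k"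
  have "(2 ^ m :: rat) * of_int 1 = 2 ^ m * of_int 1" "odd (1::int)" by simp_all
  then have "2 ^ m \<in> two_adic_ideal m"
    unfolding two_adic_ideal_def by blast
  moreover have "(1::rat) * 2 \<le> 2 ^ m * of_nat (m + 2)" by (intro mult_mono) auto
  then have "(1::rat) < of_nat (m + 2) * 2 ^ m" by (subst mult.commute) linarith
  ultimately have "2 ^ m \<in> staircase_monoid m" by (intro staircase_monoidI) auto
  moreover have "2 ^ m \<notin> staircase_monoid k"
  proof
    assume "2 ^ m \<in> staircase_monoid k"
    then obtain n where n: "k \<le> n" "2 ^ m \<in> two_adic_ideal n"
      by (rule staircase_monoidE) auto
    have "numerator (2 ^ m) = 2 ^ m"
      using quotient_of_int[of "2 ^ m"] by (simp add: numerator_def Rat.of_int_def)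
    then have "(2::int) ^ n dvd 2 ^ m" using power_two_dvd_numerator[OF n(2)] by simp
    then have "(2::int) ^ n \<le> 2 ^ m" by (rule zdvd_imp_le) simp
    then show False using n(1) \<open>m < k\<close> by simp
  qed
  ultimately show "staircase_monoid m \<noteq> staircase_monoid k" by metis
qed

theorem proposition4p6:
  "infinite {M. puiseux_monoid M \<and> antimatter M \<and> \<not> strongly_bounded_monoid M}"
proof (rule infinite_super)
  show "range staircase_monoid
      \<subseteq> {M. puiseux_monoid M \<and> antimatter M \<and> \<not> strongly_bounded_monoid M}"
    using puiseux_staircase_monoid antimatter_staircase_monoid
      not_strongly_bounded_staircase_monoid by blast
  show "infinite (range staircase_monoid)"
    using finite_imageD[OF _ inj_staircase_monoid] by auto
qed

end
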